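(* Let $\mu_0$ be a nondegenerate probability measure on $\mathscr{B}(\mathbb{R})$, with Fourier–Stieltjes transform $\phi_0$, and let $F(\cdot,t)$ be the probability distribution function corresponding to the solution $\phi(\cdot,t)$ of the Kac equation with initial datum $\phi_0$. Then $$\sup_{v\in\mathbb{R}}|F(v,t)-G_\sigma(v)|\to 0\qquad(\text{as } t\to+\infty)$$ holds true if and only if $\sigma^2:=\int_{\mathbb{R}}x^2\,\mu_0(dx)$ is finite.
   Context: $\mathscr{B}(\mathbb{R})$ is the class of Borel subsets of $\mathbb{R}$. The Fourier–Stieltjes transform of a probability measure $\mu$ on $\mathscr{B}(\mathbb{R})$ is $\xi\mapsto\int_{\mathbb{R}}e^{i\xi x}\mu(dx)$. Kac equation (Fourier form): given the transform $\phi_0$ of $\mu_0$, $$\frac{\partial}{\partial t}\phi(\xi,t)=\frac1{2\pi}\int_0^{2\pi}\phi(\xi\sin\theta,t)\,\phi(\xi\cos\theta,t)\,d\theta-\phi(\xi,t)\quad(t>0,\ \xi\in\mathbb{R}),\qquad \phi(\xi,0)=\phi_0(\xi).$$ It has exactly one solution within the Fourier–Stieltjes transforms of probability measures on $\mathscr{B}(\mathbb{R})$; write $\mu(\cdot,t)$ for the probability measure whose transform is $\phi(\cdot,t)$, and $F(v,t):=\mu((-\infty,v],t)$. $G_\sigma(v)=\int_{-\infty}^v\frac{1}{\sigma\sqrt{2\pi}}e^{-x^2/(2\sigma^2)}\,dx$ is the Gaussian distribution function with mean $0$ and variance $\sigma^2$. *)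

theory Defs
  imports "HOL-Probability.Probability"
begin

(* The equation itself is only imposed for t > 0. Continuity on {0..} ties the solution to
   its initial datum; without it the value at t = 0 would be unrelated to the evolution and
   uniqueness would fail. *)
definition kac_solution :: "(real \<Rightarrow> complex) \<Rightarrow> (real \<Rightarrow> real \<Rightarrow> complex) \<Rightarrow> bool" where
  "kac_solution \<phi>0 \<phi> \<longleftrightarrow>
     (\<forall>\<xi>. \<phi> \<xi> 0 = \<phi>0 \<xi>) \<and>
     (\<forall>\<xi>. continuous_on {0..} (\<phi> \<xi>)) \<and>
     (\<forall>\<xi>. \<forall>t>0.
        (\<phi> \<xi> has_vector_derivative
           (1 / (2 * pi)) *\<^sub>R (LINT \<theta>:{0..2 * pi}|lborel. \<phi> (\<xi> * sin \<theta>) t * \<phi> (\<xi> * cos \<theta>) t)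
             - \<phi> \<xi> t) (at t))"

definition nondegenerate :: "real measure \<Rightarrow> bool" where
  "nondegenerate M \<longleftrightarrow> (\<forall>c. M \<noteq> return borel c)"

definition gaussian_cdf :: "real \<Rightarrow> real \<Rightarrow> real" where
  "gaussian_cdf \<sigma> v = (LINT x:{..v}|lborel. normal_density 0 \<sigma> x)"

end

theory Submission
  imports Defs
begin

text \<open>
  Splitting \<open>\<phi> = R + i I\<close>, the reflection \<open>\<theta> \<mapsto> 2\<pi> - \<theta>\<close> removes \<open>I\<close> from the equation for \<open>R\<close>, and \<open>I\<close>
  solves a linear equation that forces \<open>I \<rightarrow> 0\<close>. The Gaussian \<open>g(\<xi>) = exp(-s\<xi>\<^sup>2)\<close> is a stationary
  solution because \<open>g(\<xi> sin \<theta>) g(\<xi> cos \<theta>) = g(\<xi>)\<close>, and everything else is a comparison argument.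

  If the second moment is finite then \<open>R - g\<close>, for the \<open>g\<close> of matching variance, is initially
  \<open>o(\<xi>\<^sup>2)\<close>, hence at most \<open>\<epsilon>\<xi>\<^sup>2 + K\<xi>\<^sup>4\<close>; since the circle averages of \<open>sin\<^sup>2 + cos\<^sup>2\<close> and
  \<open>sin\<^sup>4 + cos\<^sup>4\<close> are \<open>1\<close> and \<open>3/4\<close>, this bound propagates as
  \<open>\<epsilon>\<xi>\<^sup>2 + K\<xi>\<^sup>4 exp(-t/4)\<close>, so \<open>R \<rightarrow> g\<close>. If the second moment is infinite then, for every \<open>A\<close>,
  \<open>|R| \<le> exp(-A\<xi>\<^sup>2)\<close> initially on a neighbourhood of \<open>0\<close>. The equation is local in the sense that
  the value at \<open>\<xi>\<close> only involves frequencies at most \<open>|\<xi>|\<close>, so the bound persists for all times, and no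
  Gaussian of variance less than \<open>2A\<close> can be the limit.
\<close>

subsection \<open>Comparison for relaxation equations\<close>

text \<open>With the integrating factor \<open>exp \<tau>\<close> the equation becomes
  \<open>(exp * f)' = exp * k\<close>, and the hypothesis on \<open>k\<close> says exactly that this
  has norm at most \<open>(exp * w)'\<close>. The mean value inequality compares the two increments
  on [0, t].\<close>

lemma comparison_step:
  fixes f :: "real \<Rightarrow> 'a::euclidean_space" and w :: "real \<Rightarrow> real"
  assumes "0 \<le> t"
    and cont_f: "continuous_on {0..} f" and cont_w: "continuous_on {0..} w"
    and f: "\<And>\<tau>. 0 < \<tau> \<Longrightarrow> (f has_vector_derivative k \<tau> - f \<tau>) (at \<tau>)"
    and w: "\<And>\<tau>. 0 < \<tau> \<Longrightarrow> (w has_vector_derivative w' \<tau>) (at \<tau>)"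
    and k: "\<And>\<tau>. 0 < \<tau> \<Longrightarrow> norm (k \<tau>) \<le> w' \<tau> + w \<tau>"
    and init: "norm (f 0) \<le> w 0"
  shows "norm (f t) \<le> w t"
proof (cases "t = 0")
  case False
  with \<open>0 \<le> t\<close> have "0 < t" by simp
  have "norm (exp t *\<^sub>R f t - exp 0 *\<^sub>R f 0) \<le> exp t * w t - exp 0 * w 0"
  proof (rule differentiable_bound_general[OF \<open>0 < t\<close>])
    show "continuous_on {0..t} (\<lambda>\<tau>. exp \<tau> *\<^sub>R f \<tau>)" "continuous_on {0..t} (\<lambda>\<tau>. exp \<tau> * w \<tau>)"
      by (auto intro!: continuous_intros continuous_on_subset[OF cont_f] continuous_on_subset[OF cont_w])
    fix \<tau> :: real assume "0 < \<tau>"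
    have E: "(exp has_real_derivative exp \<tau>) (at \<tau>)" by (rule DERIV_exp)
    show "((\<lambda>\<tau>. exp \<tau> *\<^sub>R f \<tau>) has_vector_derivative exp \<tau> *\<^sub>R k \<tau>) (at \<tau>)"
      by (rule has_vector_derivative_eq_rhs[OF has_vector_derivative_scaleR[OF E f[OF \<open>0 < \<tau>\<close>]]])
        (simp add: algebra_simps)
    show "((\<lambda>\<tau>. exp \<tau> * w \<tau>) has_vector_derivative exp \<tau> * (w' \<tau> + w \<tau>)) (at \<tau>)"
      using has_vector_derivative_scaleR[OF E w[OF \<open>0 < \<tau>\<close>]] by (simp add: algebra_simps)
    show "norm (exp \<tau> *\<^sub>R k \<tau>) \<le> exp \<tau> * (w' \<tau> + w \<tau>)"
      using k[OF \<open>0 < \<tau>\<close>] by simp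
  qed
  moreover have "norm (exp t *\<^sub>R f t) \<le> norm (exp t *\<^sub>R f t - exp 0 *\<^sub>R f 0) + norm (f 0)"
    using norm_triangle_sub[of "exp t *\<^sub>R f t" "f 0"] by simp
  ultimately have "exp t * norm (f t) \<le> exp t * w t"
    using init by (simp only: norm_scaleR abs_exp_cancel exp_zero scaleR_one mult_1)
  then show ?thesis by simp
qed (use init in simp)

text \<open>The error term \<open>B (2t)\<^sup>n / n!\<close> is the \<open>n\<close>-th Picard iterate of the a priori bound \<open>B\<close>.\<close>

lemma comparison:
  fixes f :: "'b \<Rightarrow> real \<Rightarrow> 'a::euclidean_space" and W :: "'b \<Rightarrow> real \<Rightarrow> real"
  assumes "x \<in> S" "0 \<le> t" "0 \<le> B"
    and cont_f: "\<And>x. x \<in> S \<Longrightarrow> continuous_on {0..} (f x)"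
    and cont_W: "\<And>x. x \<in> S \<Longrightarrow> continuous_on {0..} (W x)"
    and f: "\<And>x t. x \<in> S \<Longrightarrow> 0 < t \<Longrightarrow> (f x has_vector_derivative k x t - f x t) (at t)"
    and W: "\<And>x t. x \<in> S \<Longrightarrow> 0 < t \<Longrightarrow> (W x has_vector_derivative W' x t) (at t)"
    and init: "\<And>x. x \<in> S \<Longrightarrow> norm (f x 0) \<le> W x 0"
    and bound: "\<And>x t. x \<in> S \<Longrightarrow> 0 \<le> t \<Longrightarrow> norm (f x t) \<le> W x t + B"
    and k: "\<And>x t c. x \<in> S \<Longrightarrow> 0 < t \<Longrightarrow> 0 \<le> c \<Longrightarrow> (\<And>y. y \<in> S \<Longrightarrow> norm (f y t) \<le> W y t + c) \<Longrightarrow>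
              norm (k x t) \<le> W' x t + W x t + 2 * c"
  shows "norm (f x t) \<le> W x t"
proof -
  have iterate: "norm (f x t) \<le> W x t + B * ((2 * t) ^ n / fact n)" if "x \<in> S" "0 \<le> t" for x t n
    using that
  proof (induction n arbitrary: x t)
    case 0
    then show ?case using bound by simp
  next
    case (Suc n)
    \<comment> \<open>The derivative of \<open>p (Suc n)\<close> is \<open>2 * p n\<close>,
      precisely the excess that the hypothesis on \<open>k\<close> permits for
      \<open>c = p n \<tau>\<close>. Since \<open>p (Suc n)\<close> vanishes at time 0, the initial
      inequality survives.\<close>
    define p where "p m \<tau> = B * ((2 * \<tau>) ^ m / fact m)" for m and \<tau> :: real
    have p: "(p (Suc n) has_vector_derivative 2 * p n \<tau>) (at \<tau>)" for \<tau>
      unfolding p_def has_real_derivative_iff_has_vector_derivative[symmetric]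
      by (rule derivative_eq_intros refl | simp)+
    have "norm (f x t) \<le> W x t + p (Suc n) t"
    proof (rule comparison_step[where k = "k x" and w = "\<lambda>\<tau>. W x \<tau> + p (Suc n) \<tau>" and w' = "\<lambda>\<tau>. W' x \<tau> + 2 * p n \<tau>"])
      show "continuous_on {0..} (\<lambda>\<tau>. W x \<tau> + p (Suc n) \<tau>)"
        unfolding p_def by (intro continuous_intros cont_W Suc.prems) auto
      show "norm (f x 0) \<le> W x 0 + p (Suc n) 0"
        using init Suc.prems by (simp add: p_def)
      fix \<tau> :: real assume "0 < \<tau>"
      show "((\<lambda>\<tau>. W x \<tau> + p (Suc n) \<tau>) has_vector_derivative W' x \<tau> + 2 * p n \<tau>) (at \<tau>)"
        by (intro has_vector_derivative_add W p Suc.prems \<open>0 < \<tau>\<close>)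
      \<comment> \<open>The term \<open>k\<close> may depend on \<open>f\<close> at all points of
        \<open>S\<close>, so the induction hypothesis is used at every point at time
        \<open>\<tau>\<close>, not just at \<open>x\<close>.\<close>
      have "norm (k x \<tau>) \<le> W' x \<tau> + W x \<tau> + 2 * p n \<tau>"
        using \<open>0 < \<tau>\<close> \<open>0 \<le> B\<close> Suc.prems(1) Suc.IH[of _ \<tau>] by (intro k) (auto simp: p_def)
      moreover have "0 \<le> p (Suc n) \<tau>"
        using \<open>0 < \<tau>\<close> \<open>0 \<le> B\<close> by (simp add: p_def)
      ultimately show "norm (k x \<tau>) \<le> W' x \<tau> + 2 * p n \<tau> + (W x \<tau> + p (Suc n) \<tau>)"
        by simp
    qed (use Suc.prems cont_f f in auto)
    then show ?case by (simp add: p_def)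
  qed
  have "(\<lambda>n. (2 * t) ^ n / fact n) \<longlonglongrightarrow> 0"
    using summable_LIMSEQ_zero[OF summable_exp[of "2 * t"]] by (simp add: inverse_eq_divide)
  then have "(\<lambda>n. W x t + B * ((2 * t) ^ n / fact n)) \<longlonglongrightarrow> W x t + B * 0"
    by (intro tendsto_intros)
  then show ?thesis
    using iterate[OF \<open>x \<in> S\<close> \<open>0 \<le> t\<close>] by (intro LIMSEQ_le_const) auto
qed

subsection \<open>Averages over the circle\<close>

text \<open>The gain term of the Kac equation, in the same shape as in \<open>kac_solution\<close>,
  so that unfolding matches the two. It is generic in the codomain because both complex integrands
  and their real majorants are averaged.\<close>

definition circle_avg :: "(real \<Rightarrow> 'a::euclidean_space) \<Rightarrow> 'a" where
  "circle_avg f = (1 / (2 * pi)) *\<^sub>R (LINT \<theta>:{0..2 * pi}|lborel. f \<theta>)"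

lemma integrable_on_circle:
  fixes f :: "real \<Rightarrow> 'a::euclidean_space"
  assumes "continuous_on UNIV f"
  shows "set_integrable lborel {0..2 * pi} f"
  by (rule borel_integrable_atLeastAtMost') (rule continuous_on_subset[OF assms subset_UNIV])

lemma circle_avg_diff:
  assumes "continuous_on UNIV f" "continuous_on UNIV g"
  shows "circle_avg (\<lambda>\<theta>. f \<theta> - g \<theta>) = circle_avg f - circle_avg g"
  using assms by (simp add: circle_avg_def set_integral_diff integrable_on_circle scaleR_diff_right)

lemma circle_avg_add:
  assumes "continuous_on UNIV f" "continuous_on UNIV g"
  shows "circle_avg (\<lambda>\<theta>. f \<theta> + g \<theta>) = circle_avg f + circle_avg g"
  using assms by (simp add: circle_avg_def set_integral_add integrable_on_circle scaleR_add_right)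

lemma norm_circle_avg_le:
  fixes f :: "real \<Rightarrow> 'a::euclidean_space"
  assumes "continuous_on UNIV f" "continuous_on UNIV g" "\<And>\<theta>. norm (f \<theta>) \<le> g \<theta>"
  shows "norm (circle_avg f) \<le> circle_avg g"
proof -
  have "norm (LINT \<theta>:{0..2 * pi}|lborel. f \<theta>) \<le> (LINT \<theta>:{0..2 * pi}|lborel. norm (f \<theta>))"
    by (rule set_integral_norm_bound) (intro integrable_on_circle assms)
  also have "\<dots> \<le> (LINT \<theta>:{0..2 * pi}|lborel. g \<theta>)"
    by (intro set_integral_mono integrable_on_circle continuous_intros assms)
  finally show ?thesis
    by (simp add: circle_avg_def field_simps)
qed

lemma Re_circle_avg: "continuous_on UNIV f \<Longrightarrow> Re (circle_avg f) = circle_avg (\<lambda>\<theta>. Re (f \<theta>))"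
  and Im_circle_avg: "continuous_on UNIV f \<Longrightarrow> Im (circle_avg f) = circle_avg (\<lambda>\<theta>. Im (f \<theta>))"
  using integrable_on_circle[of f]
  by (simp_all add: circle_avg_def set_lebesgue_integral_def set_integrable_def
        flip: integral_Re integral_Im)

text \<open>The substitution \<theta> -> 2\<pi> - \<theta> maps the interval to itself, flips the
  sine and fixes the cosine. Writing the integrand as a function of sine and cosine makes this
  symmetry visible.\<close>

lemma circle_avg_reflect:
  "circle_avg (\<lambda>\<theta>. f (sin \<theta>) (cos \<theta>)) = circle_avg (\<lambda>\<theta>. f (- sin \<theta>) (cos \<theta>))"
proof -
  have "(LINT \<theta>:{0..2 * pi}|lborel. f (sin \<theta>) (cos \<theta>)) =
        (LINT \<theta>|lborel. indicator {0..2 * pi} (2 * pi + (- 1) * \<theta>) *\<^sub>R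
           f (sin (2 * pi + (- 1) * \<theta>)) (cos (2 * pi + (- 1) * \<theta>)))"
    unfolding set_lebesgue_integral_def
    by (subst lborel_integral_real_affine[where c = "-1" and t = "2 * pi"]) simp_all
  also have "\<dots> = (LINT \<theta>:{0..2 * pi}|lborel. f (- sin \<theta>) (cos \<theta>))"
    unfolding set_lebesgue_integral_def
    by (intro Bochner_Integration.integral_cong)
      (auto simp: indicator_def sin_diff cos_diff)
  finally show ?thesis by (simp add: circle_avg_def)
qed

text \<open>Reflection shows that the average equals its own negative. This removes the products
  with an imaginary part at frequency \<open>\<xi> * sin \<theta>\<close>, which is odd in the
  sine.\<close>

lemma circle_avg_odd:
  fixes f :: "real \<Rightarrow> real \<Rightarrow> real"
  assumes "\<And>s c. f (- s) c = - f s c"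
  shows "circle_avg (\<lambda>\<theta>. f (sin \<theta>) (cos \<theta>)) = 0"
proof -
  have "circle_avg (\<lambda>\<theta>. - f (sin \<theta>) (cos \<theta>)) = - circle_avg (\<lambda>\<theta>. f (sin \<theta>) (cos \<theta>))"
    by (simp add: circle_avg_def set_lebesgue_integral_def)
  then show ?thesis
    using circle_avg_reflect[of f] assms by simp
qed

text \<open>The cosine runs through \<open>n\<close> full periods and integrates to zero. Every
  majorant averaged below is brought to this form, with \<open>n\<close> equal to 1, 2 or 4.\<close>

lemma circle_avg_harmonic:
  fixes a b :: real
  assumes "n \<noteq> 0"
  shows "circle_avg (\<lambda>\<theta>. a + b * cos (real n * \<theta>)) = a"
proof -
  let ?F = "\<lambda>\<theta>. a * \<theta> + b / n * sin (real n * \<theta>)"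
  have "(LINT \<theta>:{0..2 * pi}|lborel. a + b * cos (real n * \<theta>)) =
      ?F (2 * pi) - ?F 0"
    unfolding set_lebesgue_integral_def using assms
    by (intro integral_FTC_atLeastAtMost)
      (auto intro!: derivative_eq_intros continuous_intros
         simp flip: has_real_derivative_iff_has_vector_derivative)
  also have "sin (real n * (2 * pi)) = 0"
    using sin_int_2pin[of "int n"] by (simp add: mult.commute)
  finally show ?thesis by (simp add: circle_avg_def)
qed

subsection \<open>Distribution functions and Gaussians\<close>

lemma prob_abs_diff_cdf_le_1:
  assumes "real_distribution M" "real_distribution N"
  shows "\<bar>cdf M v - cdf N v\<bar> \<le> 1"
proof -
  interpret M: real_distribution M by fact
  interpret N: real_distribution N by fact
  show ?thesis
    using M.cdf_nonneg[of v] N.cdf_nonneg[of v] M.cdf_bounded_prob[of v] N.cdf_bounded_prob[of v]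
    by (simp add: abs_le_iff)
qed

text \<open>The differences are bounded by 1, so the real \<open>SUP\<close> is a genuine supremum
  and dominates each of them.\<close>

lemma abs_diff_cdf_le_SUP:
  assumes "real_distribution M" "real_distribution N"
  shows "\<bar>cdf M v - cdf N v\<bar> \<le> (SUP v. \<bar>cdf M v - cdf N v\<bar>)"
  by (rule cSUP_upper) (auto intro!: bdd_aboveI[where M = 1] prob_abs_diff_cdf_le_1 assms)

lemma cdf_surj_unit_interval:
  assumes "real_distribution N" and cont: "\<And>x. isCont (cdf N) x" and "0 < p" "p < 1"
  shows "\<exists>x. cdf N x = p"
proof -
  interpret N: real_distribution N by fact
  obtain a where a: "cdf N a < p"
    using eventually_happens[OF order_tendstoD(2)[OF N.cdf_lim_at_bot \<open>0 < p\<close>]] by auto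
  obtain b where b: "p < cdf N b"
    using eventually_happens[OF order_tendstoD(1)[OF N.cdf_lim_at_top_prob \<open>p < 1\<close>]] by auto
  have "a \<le> b"
    using a b N.cdf_nondecreasing[of b a] by linarith
  then show ?thesis
    using IVT[of "cdf N" a p b] a b cont by auto
qed

text \<open>Polya's theorem: compare both distribution functions at the \<open>1/k\<close>-quantiles of the limit.\<close>

lemma weak_conv_imp_uniform_cdf:
  assumes M: "\<And>n. real_distribution (M n)" and N: "real_distribution N"
    and cont: "\<And>x. isCont (cdf N) x" and conv: "weak_conv_m M N"
  shows "(\<lambda>n. SUP v. \<bar>cdf (M n) v - cdf N v\<bar>) \<longlonglongrightarrow> 0"
proof (rule LIMSEQ_I)
  interpret N: real_distribution N by fact
  fix e :: real assume "0 < e"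
  \<comment> \<open>The estimate below yields at most 3/k; asking for 4/k < e leaves room for a
    strict inequality after taking the supremum.\<close>
  obtain k :: nat where "4 / e < k" using reals_Archimedean2 by blast
  moreover have "0 < 4 / e" using \<open>0 < e\<close> by simp
  ultimately have "0 < real k" by linarith
  with \<open>4 / e < k\<close> \<open>0 < e\<close> have k: "0 < k" "4 / k < e"
    by (auto simp: field_simps)
  \<comment> \<open>Only interior levels are used, since the values 0 and 1 need not be
    attained.\<close>
  have "\<exists>x. cdf N x = real i / k" if "0 < i" "i < k" for i
    using that k by (intro cdf_surj_unit_interval N cont) auto
  then obtain q where q: "cdf N (q i) = real i / k" if "0 < i" "i < k" for i
    by metis
  have "\<forall>\<^sub>F n in sequentially. \<forall>i\<in>{..<k}. \<bar>cdf (M n) (q i) - cdf N (q i)\<bar> < 1 / k"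
  proof (intro eventually_ball_finite ballI)
    fix i
    have "(\<lambda>n. cdf (M n) (q i)) \<longlonglongrightarrow> cdf N (q i)"
      using conv cont by (simp add: weak_conv_m_def weak_conv_def)
    from tendstoD[OF this, of "1 / k"] k
    show "\<forall>\<^sub>F n in sequentially. \<bar>cdf (M n) (q i) - cdf N (q i)\<bar> < 1 / k"
      by (simp add: dist_real_def)
  qed simp
  then obtain n0 where n0: "\<bar>cdf (M n) (q i) - cdf N (q i)\<bar> < 1 / k" if "n \<ge> n0" "i < k" for n i
    unfolding eventually_sequentially by auto
  have "norm ((SUP v. \<bar>cdf (M n) v - cdf N v\<bar>) - 0) < e" if "n \<ge> n0" for n
  proof -
    interpret Mn: real_distribution "M n" by (rule M)
    have "\<bar>cdf (M n) v - cdf N v\<bar> \<le> 3 / k" for v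
    proof -
      \<comment> \<open>The index of the cell of length 1/k that contains
        \<open>cdf N v\<close>.\<close>
      define i where "i = nat \<lfloor>k * cdf N v\<rfloor>"
      have "0 \<le> k * cdf N v" using N.cdf_nonneg by simp
      then have "real i \<le> k * cdf N v" "k * cdf N v < real i + 1"
        unfolding i_def by linarith+
      then have i: "real i / k \<le> cdf N v" "cdf N v < (real i + 1) / k"
        using k by (simp_all add: field_simps)
      \<comment> \<open>Monotonicity bounds \<open>cdf (M n) v\<close> by its value at the next
        quantile \<open>q (i + 1)\<close>. In the top cells, where that quantile is missing, the
        right-hand side is already at least 1.\<close>
      have "cdf (M n) v \<le> cdf N v + 3 / k"
      proof (cases "i + 1 < k")
        case True
        have "cdf N v < cdf N (q (i + 1))"
          using i q[of "i + 1"] True by (simp add: add.commute)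
        then have "v \<le> q (i + 1)"
          using N.cdf_nondecreasing[of "q (i + 1)" v] by linarith
        then have "cdf (M n) v \<le> cdf (M n) (q (i + 1))"
          by (rule Mn.cdf_nondecreasing)
        also have "\<dots> < (real i + 1) / k + 1 / k"
          using n0[OF that True] q[of "i + 1"] True by (simp add: add.commute)
        also have "\<dots> \<le> cdf N v + 3 / k"
          using i k by (simp add: add_divide_distrib diff_divide_distrib)
        finally show ?thesis by simp
      next
        case False
        then have "k \<le> real i + 1" by linarith
        then have "1 \<le> (real i + 1) / k" using k by simp
        moreover have "(real i + 1) / k \<le> cdf N v + 3 / k"
          using i k by (simp add: add_divide_distrib diff_divide_distrib)
        ultimately show ?thesis using Mn.cdf_bounded_prob[of v] by linarith
      qed
      \<comment> \<open>The quantile \<open>q (i - 1)\<close> is used rather than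
        \<open>q i\<close>: its level lies strictly below \<open>cdf N v\<close>, which places it to
        the left of \<open>v\<close>, and it still exists when \<open>i = k\<close>. This choice
        costs the third 1/k.\<close>
      moreover have "cdf N v - 3 / k \<le> cdf (M n) v"
      proof (cases "1 < i")
        case True
        have "real i \<le> k"
          using \<open>real i \<le> k * cdf N v\<close> N.cdf_bounded_prob[of v] k
          by (smt (verit) mult_left_le of_nat_0_le_iff)
        then have j: "0 < i - 1" "i - 1 < k" using True by linarith+
        have "cdf N (q (i - 1)) < cdf N v"
          using i q[OF j] j k True by (simp add: diff_divide_distrib add_divide_distrib of_nat_diff)
        then have "q (i - 1) \<le> v"
          using N.cdf_nondecreasing[of v "q (i - 1)"] by linarith
        then have "cdf (M n) (q (i - 1)) \<le> cdf (M n) v"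
          by (rule Mn.cdf_nondecreasing)
        moreover have "(real i - 1) / k - 1 / k < cdf (M n) (q (i - 1))"
          using n0[OF that j(2)] q[OF j] True by (simp add: of_nat_diff abs_less_iff)
        moreover have "cdf N v - 3 / k < (real i - 1) / k - 1 / k"
          using i k by (simp add: add_divide_distrib diff_divide_distrib)
        ultimately show ?thesis by linarith
      next
        case False
        then have "(real i + 1) / k \<le> 3 / k" using k by (simp add: divide_right_mono)
        then show ?thesis using i Mn.cdf_nonneg[of v] by linarith
      qed
      ultimately show ?thesis by (simp add: abs_le_iff)
    qed
    then have "(SUP v. \<bar>cdf (M n) v - cdf N v\<bar>) \<le> 3 / k"
      by (intro cSUP_least) auto
    moreover have "0 \<le> (SUP v. \<bar>cdf (M n) v - cdf N v\<bar>)"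
      using abs_diff_cdf_le_SUP[OF M N, of n 0] abs_ge_zero by (rule order_trans[rotated])
    moreover have "3 / k < 4 / k" using k by (simp add: divide_strict_right_mono)
    ultimately show ?thesis using k by simp
  qed
  then show "\<exists>n0. \<forall>n\<ge>n0. norm ((SUP v. \<bar>cdf (M n) v - cdf N v\<bar>) - 0) < e" by blast
qed

section \<open>Centred Gaussian laws and their transforms\<close>

abbreviation gaussian :: "real \<Rightarrow> real measure" where
  "gaussian \<sigma> \<equiv> density lborel (normal_density 0 \<sigma>)"

lemma real_distribution_gaussian: "0 < \<sigma> \<Longrightarrow> real_distribution (gaussian \<sigma>)"
  using prob_space_normal_density[of \<sigma> 0] by (auto simp: real_distribution_def real_distribution_axioms_def)

lemma cdf_gaussian:
  assumes "0 < \<sigma>"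
  shows "cdf (gaussian \<sigma>) v = gaussian_cdf \<sigma> v"
proof -
  interpret real_distribution "gaussian \<sigma>" by (rule real_distribution_gaussian[OF assms])
  have "cdf (gaussian \<sigma>) v = (LINT x|gaussian \<sigma>. indicator {..v} x)"
    by (simp add: cdf_def)
  also have "\<dots> = gaussian_cdf \<sigma> v"
    by (subst integral_density) (auto simp: gaussian_cdf_def set_lebesgue_integral_def mult.commute)
  finally show ?thesis .
qed

lemma isCont_cdf_gaussian:
  assumes "0 < \<sigma>"
  shows "isCont (cdf (gaussian \<sigma>)) x"
proof -
  interpret real_distribution "gaussian \<sigma>" by (rule real_distribution_gaussian[OF assms])
  have "AE y in lborel. y \<noteq> x" by (rule AE_lborel_singleton)
  then have "emeasure (gaussian \<sigma>) {x} = 0"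
    by (subst emeasure_density) (auto simp: nn_integral_0_iff_AE indicator_def elim!: eventually_mono)
  then show ?thesis by (simp add: isCont_cdf measure_def)
qed

text \<open>Substituting \<open>\<sigma> * x\<close> for \<open>x\<close> reduces the integral to
  the standard normal law at frequency \<open>\<xi> * \<sigma>\<close>.\<close>

lemma char_gaussian:
  assumes "0 < \<sigma>"
  shows "char (gaussian \<sigma>) \<xi> = exp (- (\<sigma>\<^sup>2 * \<xi>\<^sup>2 / 2))"
proof -
  have scale: "\<sigma> * normal_density 0 \<sigma> (\<sigma> * x) = std_normal_density x" for x
    using assms by (simp add: normal_density_def power_mult_distrib real_sqrt_mult)
  have "char (gaussian \<sigma>) \<xi> = (LINT x|lborel. normal_density 0 \<sigma> x *\<^sub>R iexp (\<xi> * x))"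
    unfolding char_def by (subst integral_density) auto
  also have "\<dots> = (LINT x|lborel. (\<sigma> * normal_density 0 \<sigma> (\<sigma> * x)) *\<^sub>R iexp ((\<xi> * \<sigma>) * x))"
    using assms by (subst lborel_integral_real_affine[where c = \<sigma> and t = 0])
      (simp_all add: mult.assoc flip: integral_scaleR_right)
  also have "\<dots> = char std_normal_distribution (\<xi> * \<sigma>)"
    unfolding char_def scale by (subst integral_density) auto
  finally show ?thesis
    by (simp add: char_std_normal_distribution power_mult_distrib mult.commute)
qed

text \<open>Levy's continuity theorem links transforms to weak convergence, and Polya's theorem
  upgrades weak convergence to uniform convergence because the Gaussian distribution function is
  continuous. Both concern sequences of measures, so time is sampled along an arbitrary sequence
  tending to infinity.\<close>

lemma uniform_cdf_gaussian_iff_char: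
  fixes \<mu> :: "real \<Rightarrow> real measure"
  assumes \<mu>: "\<And>t. 0 \<le> t \<Longrightarrow> real_distribution (\<mu> t)" and "0 < \<sigma>"
  shows "((\<lambda>t. SUP v. \<bar>cdf (\<mu> t) v - gaussian_cdf \<sigma> v\<bar>) \<longlongrightarrow> 0) at_top \<longleftrightarrow>
    (\<forall>\<xi>. ((\<lambda>t. char (\<mu> t) \<xi>) \<longlongrightarrow> complex_of_real (exp (- (\<sigma>\<^sup>2 * \<xi>\<^sup>2 / 2)))) at_top)"
    (is "?cdf \<longleftrightarrow> ?char")
proof (intro iffI allI tendsto_at_topI_sequentially)
  note G = real_distribution_gaussian[OF \<open>0 < \<sigma>\<close>]
  fix X :: "nat \<Rightarrow> real" assume X: "filterlim X at_top sequentially"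
  \<comment> \<open>The measures are known to be probabilities only at nonnegative times, so the
    sequence is shifted past its possibly negative beginning.\<close>
  then obtain k where "\<And>n. n \<ge> k \<Longrightarrow> 0 \<le> X n"
    unfolding filterlim_at_top eventually_sequentially by blast
  then have M: "real_distribution (\<mu> (X (n + k)))" for n
    by (intro \<mu>) simp
  have Xk: "filterlim (\<lambda>n. X (n + k)) at_top sequentially"
    by (rule filterlim_compose[OF X filterlim_add_const_nat_at_top])
  {
    fix \<xi> assume ?cdf
    from filterlim_compose[OF this Xk] have "(\<lambda>n. SUP v. \<bar>cdf (\<mu> (X (n + k))) v - cdf (gaussian \<sigma>) v\<bar>) \<longlonglongrightarrow> 0"
      by (simp add: cdf_gaussian \<open>0 < \<sigma>\<close>)
    then have "(\<lambda>n. \<bar>cdf (\<mu> (X (n + k))) v - cdf (gaussian \<sigma>) v\<bar>) \<longlonglongrightarrow> 0" for v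
      using abs_diff_cdf_le_SUP[OF M G]
      by (intro Lim_null_comparison[where f = "\<lambda>n. \<bar>cdf (\<mu> (X (n + k))) v - cdf (gaussian \<sigma>) v\<bar>"])
        (simp_all add: always_eventually)
    then have "weak_conv_m (\<lambda>n. \<mu> (X (n + k))) (gaussian \<sigma>)"
      unfolding weak_conv_m_def weak_conv_def tendsto_rabs_zero_iff by (blast intro: LIM_zero_cancel)
    from levy_continuity1[OF M G this, of \<xi>]
    show "(\<lambda>n. char (\<mu> (X n)) \<xi>) \<longlonglongrightarrow> complex_of_real (exp (- (\<sigma>\<^sup>2 * \<xi>\<^sup>2 / 2)))"
      unfolding char_gaussian[OF \<open>0 < \<sigma>\<close>] by (rule LIMSEQ_offset)
  next
    assume ?char
    then have "(\<lambda>n. char (\<mu> (X (n + k))) \<xi>) \<longlonglongrightarrow> char (gaussian \<sigma>) \<xi>" for \<xi>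
      unfolding char_gaussian[OF \<open>0 < \<sigma>\<close>] by (intro filterlim_compose[OF _ Xk]) simp
    then have "weak_conv_m (\<lambda>n. \<mu> (X (n + k))) (gaussian \<sigma>)"
      by (intro levy_continuity M G)
    then have "(\<lambda>n. SUP v. \<bar>cdf (\<mu> (X (n + k))) v - cdf (gaussian \<sigma>) v\<bar>) \<longlonglongrightarrow> 0"
      by (intro weak_conv_imp_uniform_cdf M G isCont_cdf_gaussian \<open>0 < \<sigma>\<close>)
    then have "(\<lambda>n. SUP v. \<bar>cdf (\<mu> (X (n + k))) v - gaussian_cdf \<sigma> v\<bar>) \<longlonglongrightarrow> 0"
      by (simp add: cdf_gaussian \<open>0 < \<sigma>\<close>)
    then show "(\<lambda>n. SUP v. \<bar>cdf (\<mu> (X n)) v - gaussian_cdf \<sigma> v\<bar>) \<longlonglongrightarrow> 0"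
      by (rule LIMSEQ_offset)
  }
qed

subsection \<open>Characteristic functions near the origin\<close>

context real_distribution
begin

lemma Re_char: "Re (char M \<xi>) = expectation (\<lambda>x. cos (\<xi> * x))"
  and Im_char: "Im (char M \<xi>) = expectation (\<lambda>x. sin (\<xi> * x))"
proof -
  have I: "integrable M (\<lambda>x. iexp (\<xi> * x))" by (rule integrable_iexp) simp_all
  show "Re (char M \<xi>) = expectation (\<lambda>x. cos (\<xi> * x))"
    "Im (char M \<xi>) = expectation (\<lambda>x. sin (\<xi> * x))"
    unfolding char_def integral_Re[OF I, symmetric] integral_Im[OF I, symmetric]
    by (simp_all add: Re_exp Im_exp)
qed

text \<open>The second-order Taylor remainder is at most \<open>\<xi>\<^sup>2 * h \<xi>\<close>, and
  \<open>h\<close> tends to 0 at the origin.\<close>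

lemma Re_char_second_order:
  assumes "integrable M (\<lambda>x. x\<^sup>2)" "0 < e"
  shows "\<exists>r>0. \<forall>\<xi>. \<bar>\<xi>\<bar> < r \<longrightarrow> \<bar>Re (char M \<xi>) - (1 - expectation (\<lambda>x. x\<^sup>2) * \<xi>\<^sup>2 / 2)\<bar> \<le> e * \<xi>\<^sup>2"
proof -
  have moments: "integrable M (\<lambda>x. x ^ k)" if "k \<le> 2" for k
  proof -
    have "k = 0 \<or> k = 1 \<or> k = 2" using that by linarith
    moreover have "integrable M (\<lambda>x. x)"
      by (rule square_integrable_imp_integrable[OF _ assms(1)]) simp
    ultimately show ?thesis using assms(1) by auto
  qed
  define h where "h \<xi> = expectation (\<lambda>x. min (6 * x\<^sup>2) (\<bar>\<xi>\<bar> * \<bar>x\<bar> ^ 3))" for \<xi>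
  have taylor: "\<bar>Re (char M \<xi>) - (1 - expectation (\<lambda>x. x\<^sup>2) * \<xi>\<^sup>2 / 2)\<bar> \<le> \<xi>\<^sup>2 * h \<xi>" for \<xi>
  proof -
    let ?p = "\<Sum>k\<le>2. ((\<i> * \<xi>) ^ k / fact k) * expectation (\<lambda>x. x ^ k)"
    have "\<bar>Re (char M \<xi> - ?p)\<bar> \<le> cmod (char M \<xi> - ?p)" by (rule abs_Re_le_cmod)
    also have "\<dots> \<le> \<xi>\<^sup>2 / 6 * h \<xi>"
      using char_approx2[of 2 \<xi>, OF moments] by (simp add: h_def fact_numeral mult.commute)
    also have "\<dots> \<le> \<xi>\<^sup>2 * h \<xi>"
      unfolding h_def by (intro mult_right_mono integral_nonneg_AE) auto
    \<comment> \<open>The first-moment term is purely imaginary and drops out of the real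
      part.\<close>
    also have "Re (char M \<xi> - ?p) = Re (char M \<xi>) - (1 - expectation (\<lambda>x. x\<^sup>2) * \<xi>\<^sup>2 / 2)"
      using prob_space by (simp add: numeral_2_eq_2 power2_eq_square)
    finally show ?thesis .
  qed
  \<comment> \<open>For fixed \<open>x\<close> the second argument of the minimum vanishes with
    \<xi>; the first, \<open>6 * x\<^sup>2\<close>, is an integrable dominating function.\<close>
  have "(h \<longlongrightarrow> 0) (at 0)"
    unfolding tendsto_at_iff_sequentially comp_def
  proof (intro allI impI)
    fix X :: "nat \<Rightarrow> real" assume "X \<longlonglongrightarrow> 0"
    then have "(\<lambda>n. min (6 * x\<^sup>2) (\<bar>X n\<bar> * \<bar>x\<bar> ^ 3)) \<longlonglongrightarrow> min (6 * x\<^sup>2) (\<bar>0\<bar> * \<bar>x\<bar> ^ 3)" for x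
      by (intro tendsto_intros)
    then have "(\<lambda>n. h (X n)) \<longlonglongrightarrow> expectation (\<lambda>x. 0)"
      unfolding h_def using assms
      by (intro integral_dominated_convergence[where w = "\<lambda>x. 6 * x\<^sup>2"]) auto
    then show "(\<lambda>n. h (X n)) \<longlonglongrightarrow> 0" by simp
  qed
  from order_tendstoD(2)[OF this \<open>0 < e\<close>] obtain r where r: "0 < r" "\<And>\<xi>. \<xi> \<noteq> 0 \<Longrightarrow> \<bar>\<xi>\<bar> < r \<Longrightarrow> h \<xi> < e"
    by (auto simp: eventually_at dist_real_def)
  have "\<bar>Re (char M \<xi>) - (1 - expectation (\<lambda>x. x\<^sup>2) * \<xi>\<^sup>2 / 2)\<bar> \<le> e * \<xi>\<^sup>2" if "\<bar>\<xi>\<bar> < r" for \<xi>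
  proof (cases "\<xi> = 0")
    case False
    then have "\<xi>\<^sup>2 * h \<xi> \<le> \<xi>\<^sup>2 * e"
      using r that by (intro mult_left_mono) (auto intro: less_imp_le)
    with taylor[of \<xi>] show ?thesis by (simp add: mult.commute)
  qed (simp add: char_zero)
  with r show ?thesis by blast
qed

text \<open>The truncated second moments are unbounded, and truncation at \<open>n\<close> is what a
  quadratic bound on \<open>cos (\<xi> * x)\<close> can see when |\<xi>| is at most 1/n.\<close>

lemma Re_char_infinite_variance:
  assumes "\<not> integrable M (\<lambda>x. x\<^sup>2)"
  shows "\<exists>r>0. \<forall>\<xi>. \<bar>\<xi>\<bar> \<le> r \<longrightarrow> Re (char M \<xi>) \<le> 1 - A * \<xi>\<^sup>2"
proof -
  define h where "h n x = x\<^sup>2 * indicator {- real n..real n} x" for n x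
  have int_h: "integrable M (h n)" for n
  proof (rule integrable_const_bound[of _ "(real n)\<^sup>2"])
    show "AE x in M. norm (h n x) \<le> (real n)\<^sup>2"
      by (auto simp: h_def indicator_def abs_le_square_iff[symmetric])
  qed (simp add: h_def[abs_def] measurable_finite_borel)
  have mono_h: "mono (\<lambda>n. h n x)" for x
    by (intro monoI) (auto simp: h_def indicator_def)
  have mono_E: "mono (\<lambda>n. expectation (h n))"
    by (intro monoI integral_mono int_h monoD[OF mono_h])
  \<comment> \<open>Otherwise monotone convergence would make the square integrable. The factor 4
    compensates the coefficient 1/4 in \<open>cos_le\<close>.\<close>
  have "\<exists>n. 4 * A < expectation (h n)"
  proof (rule ccontr)
    assume "\<nexists>n. 4 * A < expectation (h n)"
    then have "bdd_above (range (\<lambda>n. expectation (h n)))"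
      by (intro bdd_aboveI[where M = "4 * A"]) (auto simp: not_less)
    then have "(\<lambda>n. expectation (h n)) \<longlonglongrightarrow> (SUP n. expectation (h n))"
      by (intro LIMSEQ_incseq_SUP) (use mono_E in simp_all)
    moreover have "(\<lambda>n. h n x) \<longlonglongrightarrow> x\<^sup>2" for x
    proof (rule tendsto_eventually)
      obtain m :: nat where "\<bar>x\<bar> \<le> m" using real_arch_simple by blast
      then show "\<forall>\<^sub>F n in sequentially. h n x = x\<^sup>2"
        unfolding eventually_sequentially h_def by (intro exI[of _ m]) (auto simp: indicator_def)
    qed
    ultimately have "integrable M (\<lambda>x. x\<^sup>2)"
      by (intro integral_monotone_convergence_nonneg(1)[where f = h, OF int_h] AE_I2 mono_h)
        (simp_all add: h_def)
    with assms show False by contradiction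
  qed
  then obtain n0 where "4 * A < expectation (h n0)" ..
  \<comment> \<open>Passing to the successor keeps the truncation level positive, so that its
    reciprocal can serve as the radius.\<close>
  then have n: "4 * A < expectation (h (Suc n0))"
    using monoD[OF mono_E, of n0 "Suc n0"] by simp
  \<comment> \<open>Lowering the Taylor coefficient from 1/2 to 1/4 absorbs the quartic error on
    [-1, 1].\<close>
  have cos_le: "cos y \<le> 1 - y\<^sup>2 / 4" if "\<bar>y\<bar> \<le> 1" for y :: real
  proof -
    have "Re (iexp y - (\<Sum>k\<le>3. (\<i> * y) ^ k / fact k)) = cos y - (1 - y\<^sup>2 / 2)"
      by (simp add: numeral_3_eq_3 Re_exp power2_eq_square)
    then have "\<bar>cos y - (1 - y\<^sup>2 / 2)\<bar> \<le> cmod (iexp y - (\<Sum>k\<le>3. (\<i> * y) ^ k / fact k))"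
      using abs_Re_le_cmod by metis
    also have "\<dots> \<le> \<bar>y\<bar> ^ 4 / 24"
      using iexp_approx1[of y 3] by (simp add: fact_numeral)
    finally have "\<bar>cos y - (1 - y\<^sup>2 / 2)\<bar> \<le> \<bar>y\<bar> ^ 4 / 24" .
    moreover have "\<bar>y\<bar> ^ 4 \<le> y\<^sup>2"
      using that power_decreasing[of 2 4 "\<bar>y\<bar>"] by simp
    ultimately show ?thesis by linarith
  qed
  have "Re (char M \<xi>) \<le> 1 - A * \<xi>\<^sup>2" if "\<bar>\<xi>\<bar> \<le> 1 / Suc n0" for \<xi>
  proof -
    \<comment> \<open>Within the truncation range |\<xi> x| is at most 1; outside it
      \<open>h\<close> is zero and the bound reads \<open>cos (\<xi> * x) \<le> 1\<close>.\<close>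
    have "cos (\<xi> * x) \<le> 1 - \<xi>\<^sup>2 / 4 * h (Suc n0) x" for x
    proof (cases "\<bar>x\<bar> \<le> Suc n0")
      case True
      have "\<bar>\<xi> * x\<bar> \<le> 1 / Suc n0 * Suc n0"
        unfolding abs_mult by (intro mult_mono that True) auto
      then have "\<bar>\<xi> * x\<bar> \<le> 1" by simp
      from cos_le[OF this] True show ?thesis
        by (auto simp: h_def indicator_def power_mult_distrib abs_le_iff)
    qed (auto simp: h_def indicator_def)
    then have "expectation (\<lambda>x. cos (\<xi> * x)) \<le> expectation (\<lambda>x. 1 - \<xi>\<^sup>2 / 4 * h (Suc n0) x)"
      by (intro integral_mono integrable_const_bound[where f = "\<lambda>x. cos (\<xi> * x)" and B = 1]
          Bochner_Integration.integrable_diff integrable_mult_right int_h) auto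
    also have "\<dots> = 1 - \<xi>\<^sup>2 / 4 * expectation (h (Suc n0))"
      using int_h prob_space by simp
    also have "\<dots> \<le> 1 - \<xi>\<^sup>2 / 4 * (4 * A)"
      using n by (intro diff_left_mono mult_left_mono) auto
    finally show ?thesis by (simp add: Re_char mult.commute)
  qed
  then show ?thesis by (intro exI[of _ "1 / Suc n0"]) simp
qed

end

section \<open>Elementary estimates for products, exponentials and limits\<close>

lemma abs_mult_diff_le:
  fixes a b a' b' :: real
  assumes "\<bar>b\<bar> \<le> 1" "\<bar>a'\<bar> \<le> 1"
  shows "\<bar>a * b - a' * b'\<bar> \<le> \<bar>a - a'\<bar> + \<bar>b - b'\<bar>"
proof -
  have "\<bar>a * b - a' * b'\<bar> = \<bar>(a - a') * b + a' * (b - b')\<bar>" by (simp add: algebra_simps)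
  also have "\<dots> \<le> \<bar>a - a'\<bar> * \<bar>b\<bar> + \<bar>a'\<bar> * \<bar>b - b'\<bar>"
    using abs_triangle_ineq by (simp flip: abs_mult)
  also have "\<dots> \<le> \<bar>a - a'\<bar> * 1 + 1 * \<bar>b - b'\<bar>"
    by (intro add_mono mult_mono assms) auto
  finally show ?thesis by simp
qed

text \<open>For the upper bound, \<open>1 - x + x\<^sup>2 / 2\<close> times
  \<open>1 + x + x\<^sup>2 / 2\<close> is at least 1, and the second factor is at most
  \<open>exp x\<close>.\<close>

lemma abs_exp_minus_quadratic_le:
  fixes x :: real
  assumes "0 \<le> x"
  shows "\<bar>exp (- x) - (1 - x)\<bar> \<le> x\<^sup>2 / 2"
proof -
  have "(1 - x + x\<^sup>2 / 2) * (1 + x + x\<^sup>2 / 2) = 1 + (x\<^sup>2)\<^sup>2 / 4"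
    by (simp add: field_simps power2_eq_square)
  then have "1 \<le> (1 - x + x\<^sup>2 / 2) * (1 + x + x\<^sup>2 / 2)" by simp
  also have "0 \<le> (1 - x)\<^sup>2 + 1" by simp
  then have "0 \<le> 1 - x + x\<^sup>2 / 2" by (simp add: power2_eq_square algebra_simps)
  then have "(1 - x + x\<^sup>2 / 2) * (1 + x + x\<^sup>2 / 2) \<le> (1 - x + x\<^sup>2 / 2) * exp x"
    by (intro mult_left_mono exp_lower_Taylor_quadratic assms)
  finally have "exp (- x) \<le> 1 - x + x\<^sup>2 / 2"
    by (simp add: exp_minus field_simps)
  moreover have "1 - x \<le> exp (- x)" using exp_ge_add_one_self[of "- x"] by simp
  ultimately show ?thesis by (simp add: abs_le_iff)
qed

lemma gaussian_mult_sin_cos: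
  fixes s :: real
  shows "exp (- (s * (x * sin \<theta>)\<^sup>2)) * exp (- (s * (x * cos \<theta>)\<^sup>2)) = exp (- (s * x\<^sup>2))"
proof -
  have "s * (x * sin \<theta>)\<^sup>2 + s * (x * cos \<theta>)\<^sup>2 = s * x\<^sup>2 * ((sin \<theta>)\<^sup>2 + (cos \<theta>)\<^sup>2)"
    by (simp only: power_mult_distrib distrib_left mult.assoc)
  then show ?thesis
    by (simp only: exp_add[symmetric] minus_add_distrib[symmetric] sin_cos_squared_add mult_1_right)
qed

lemma tendsto_0_of_exp_bound:
  fixes f :: "real \<Rightarrow> real"
  assumes "0 < a"
    and bound: "\<And>e. 0 < e \<Longrightarrow> \<exists>K. \<forall>t\<ge>0. \<bar>f t\<bar> \<le> e * C + K * exp (- (a * t))"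
  shows "(f \<longlongrightarrow> 0) at_top"
proof (rule tendstoI)
  fix e :: real assume "0 < e"
  \<comment> \<open>Chosen so that \<open>d * C\<close> is at most \<open>e / 2\<close>; the added 1
    avoids division by zero. \<open>K\<close> may depend on \<open>d\<close>, but its term decays
    once \<open>d\<close> is fixed.\<close>
  define d where "d = e / (2 * (\<bar>C\<bar> + 1))"
  have "0 < d" using \<open>0 < e\<close> by (simp add: d_def)
  have "d * C \<le> d * (\<bar>C\<bar> + 1)" using \<open>0 < d\<close> by simp
  also have "\<dots> = e / 2" by (simp add: d_def field_simps add_pos_nonneg)
  finally have dC: "d * C \<le> e / 2" .
  obtain K where K: "\<And>t. 0 \<le> t \<Longrightarrow> \<bar>f t\<bar> \<le> d * C + K * exp (- (a * t))"
    using bound[OF \<open>0 < d\<close>] by blast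
  have "((\<lambda>t. K * exp (- (a * t))) \<longlongrightarrow> K * 0) at_top"
    using \<open>0 < a\<close>
    by (intro tendsto_mult_left filterlim_compose[OF exp_at_bot] filterlim_compose[OF filterlim_uminus_at_bot_at_top]
        filterlim_tendsto_pos_mult_at_top[OF tendsto_const _ filterlim_ident])
  then have "\<forall>\<^sub>F t in at_top. K * exp (- (a * t)) < e / 2"
    using \<open>0 < e\<close> by (intro order_tendstoD(2)[where y = "K * 0"]) auto
  then show "\<forall>\<^sub>F t in at_top. dist (f t) 0 < e"
    using eventually_ge_at_top[of 0]
  proof eventually_elim
    case (elim t)
    then show ?case using K[of t] dC by simp
  qed
qed

subsection \<open>The Kac equation\<close>

text \<open>The initial datum is not a separate parameter: time 0 is included, and
  \<open>\<mu> 0\<close> plays that role.\<close>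

locale kac_flow =
  fixes \<phi> :: "real \<Rightarrow> real \<Rightarrow> complex" and \<mu> :: "real \<Rightarrow> real measure"
  assumes cont_time: "continuous_on {0..} (\<phi> \<xi>)"
    and equation: "0 < t \<Longrightarrow> (\<phi> \<xi> has_vector_derivative
          circle_avg (\<lambda>\<theta>. \<phi> (\<xi> * sin \<theta>) t * \<phi> (\<xi> * cos \<theta>) t) - \<phi> \<xi> t) (at t)"
    and distribution: "0 \<le> t \<Longrightarrow> real_distribution (\<mu> t)"
    and transform: "0 \<le> t \<Longrightarrow> \<phi> \<xi> t = char (\<mu> t) \<xi>"
begin

lemma norm_le_1: "0 \<le> t \<Longrightarrow> norm (\<phi> \<xi> t) \<le> 1"
  using real_distribution.cmod_char_le_1[OF distribution] transform by simp

lemma Re_le_1: "0 \<le> t \<Longrightarrow> \<bar>Re (\<phi> \<xi> t)\<bar> \<le> 1"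
  and Im_le_1: "0 \<le> t \<Longrightarrow> \<bar>Im (\<phi> \<xi> t)\<bar> \<le> 1"
  using order_trans[OF abs_Re_le_cmod norm_le_1] order_trans[OF abs_Im_le_cmod norm_le_1] by blast+

lemma Im_odd: "0 \<le> t \<Longrightarrow> Im (\<phi> (- \<xi>) t) = - Im (\<phi> \<xi> t)"
  using real_distribution.Im_char[OF distribution] transform by simp

lemma cont_freq [continuous_intros]:
  assumes "0 \<le> t" "continuous_on A f"
  shows "continuous_on A (\<lambda>\<theta>. \<phi> (f \<theta>) t)"
proof -
  have "continuous_on UNIV (\<lambda>\<xi>. \<phi> \<xi> t)"
    using real_distribution.isCont_char[OF distribution[OF \<open>0 \<le> t\<close>]]
    by (simp add: transform[OF \<open>0 \<le> t\<close>] continuous_at_imp_continuous_on)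
  from continuous_on_compose2[OF this assms(2)] show ?thesis by simp
qed

lemma Re_equation:
  assumes "0 < t"
  shows "((\<lambda>t. Re (\<phi> \<xi> t)) has_vector_derivative
    circle_avg (\<lambda>\<theta>. Re (\<phi> (\<xi> * sin \<theta>) t) * Re (\<phi> (\<xi> * cos \<theta>) t)) - Re (\<phi> \<xi> t)) (at t)"
proof -
  let ?R = "\<lambda>\<theta>. Re (\<phi> (\<xi> * sin \<theta>) t) * Re (\<phi> (\<xi> * cos \<theta>) t)"
  let ?I = "\<lambda>s c. Im (\<phi> (\<xi> * s) t) * Im (\<phi> (\<xi> * c) t)"
  have "Re (circle_avg (\<lambda>\<theta>. \<phi> (\<xi> * sin \<theta>) t * \<phi> (\<xi> * cos \<theta>) t)) = circle_avg (\<lambda>\<theta>. ?R \<theta> - ?I (sin \<theta>) (cos \<theta>))"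
    using assms by (subst Re_circle_avg) (auto intro!: continuous_intros)
  also have "\<dots> = circle_avg ?R - circle_avg (\<lambda>\<theta>. ?I (sin \<theta>) (cos \<theta>))"
    using assms by (intro circle_avg_diff) (auto intro!: continuous_intros)
  also have "circle_avg (\<lambda>\<theta>. ?I (sin \<theta>) (cos \<theta>)) = 0"
    using assms by (intro circle_avg_odd) (simp add: Im_odd)
  finally show ?thesis
    using bounded_linear.has_vector_derivative[OF bounded_linear_Re equation[OF assms, of \<xi>]] by simp
qed

text \<open>Of the two mixed products, the one with the imaginary part at the sine is odd under
  reflection and averages to zero. What remains is linear in the imaginary part, with a coefficient
  of modulus at most 1.\<close>

lemma Im_equation:
  assumes "0 < t"
  shows "((\<lambda>t. Im (\<phi> \<xi> t)) has_vector_derivative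
    circle_avg (\<lambda>\<theta>. Re (\<phi> (\<xi> * sin \<theta>) t) * Im (\<phi> (\<xi> * cos \<theta>) t)) - Im (\<phi> \<xi> t)) (at t)"
proof -
  let ?C = "\<lambda>\<theta>. Re (\<phi> (\<xi> * sin \<theta>) t) * Im (\<phi> (\<xi> * cos \<theta>) t)"
  let ?S = "\<lambda>s c. Im (\<phi> (\<xi> * s) t) * Re (\<phi> (\<xi> * c) t)"
  have "Im (circle_avg (\<lambda>\<theta>. \<phi> (\<xi> * sin \<theta>) t * \<phi> (\<xi> * cos \<theta>) t)) = circle_avg (\<lambda>\<theta>. ?C \<theta> + ?S (sin \<theta>) (cos \<theta>))"
    using assms by (subst Im_circle_avg) (auto intro!: continuous_intros)
  also have "\<dots> = circle_avg ?C + circle_avg (\<lambda>\<theta>. ?S (sin \<theta>) (cos \<theta>))"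
    using assms by (intro circle_avg_add) (auto intro!: continuous_intros)
  also have "circle_avg (\<lambda>\<theta>. ?S (sin \<theta>) (cos \<theta>)) = 0"
    using assms by (intro circle_avg_odd) (simp add: Im_odd)
  finally show ?thesis
    using bounded_linear.has_vector_derivative[OF bounded_linear_Im equation[OF assms, of \<xi>]] by simp
qed

section \<open>Bounds propagated by the equation\<close>

text \<open>Averaging keeps the constant \<open>e\<close> and halves the quadratic term, since
  \<open>cos\<^sup>2\<close> has mean 1/2. The loss term then leaves the decay rate 1 - 1/2.\<close>

lemma Im_decay:
  assumes "0 \<le> t" "0 \<le> e" "0 \<le> K" and init: "\<And>\<xi>. \<bar>Im (\<phi> \<xi> 0)\<bar> \<le> e + K * \<xi>\<^sup>2"
  shows "\<bar>Im (\<phi> \<xi> t)\<bar> \<le> e + K * \<xi>\<^sup>2 * exp (- (t / 2))"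
proof -
  let ?W = "\<lambda>\<xi> t. e + K * \<xi>\<^sup>2 * exp (- (t / 2))"
  have "norm (Im (\<phi> \<xi> t)) \<le> ?W \<xi> t"
  proof (rule comparison[where S = UNIV and B = 1 and W = ?W and f = "\<lambda>\<xi> t. Im (\<phi> \<xi> t)"
        and k = "\<lambda>\<xi> t. circle_avg (\<lambda>\<theta>. Re (\<phi> (\<xi> * sin \<theta>) t) * Im (\<phi> (\<xi> * cos \<theta>) t))"
        and W' = "\<lambda>\<xi> t. - (K * \<xi>\<^sup>2 * exp (- (t / 2)) / 2)"])
    show "continuous_on {0..} (\<lambda>t. Im (\<phi> \<xi> t))" for \<xi>
      by (intro continuous_intros cont_time)
    show "continuous_on {0..} (?W \<xi>)" for \<xi>
      by (intro continuous_intros) auto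
    show "(?W \<xi> has_vector_derivative - (K * \<xi>\<^sup>2 * exp (- (t / 2)) / 2)) (at t)" for \<xi> t
      unfolding has_real_derivative_iff_has_vector_derivative[symmetric]
      by (rule derivative_eq_intros refl | simp)+
    show "norm (Im (\<phi> \<xi> t)) \<le> ?W \<xi> t + 1" if "0 \<le> t" for \<xi> t
      using Im_le_1[OF that, of \<xi>] assms by (simp add: add_increasing)
  next
    fix \<xi> t c :: real
    assume "0 < t" "0 \<le> c" and c: "\<And>\<xi>. \<xi> \<in> UNIV \<Longrightarrow> norm (Im (\<phi> \<xi> t)) \<le> ?W \<xi> t + c"
    define E where "E = K * \<xi>\<^sup>2 * exp (- (t / 2))"
    have "norm (circle_avg (\<lambda>\<theta>. Re (\<phi> (\<xi> * sin \<theta>) t) * Im (\<phi> (\<xi> * cos \<theta>) t)))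
        \<le> circle_avg (\<lambda>\<theta>. (e + E / 2 + c) + E / 2 * cos (real 2 * \<theta>))"
    proof (rule norm_circle_avg_le)
      fix \<theta> :: real
      have half: "(cos \<theta>)\<^sup>2 = 1 / 2 + cos (real 2 * \<theta>) / 2" by (simp add: cos_double_cos diff_divide_distrib)
      have "norm (Re (\<phi> (\<xi> * sin \<theta>) t) * Im (\<phi> (\<xi> * cos \<theta>) t)) \<le> 1 * \<bar>Im (\<phi> (\<xi> * cos \<theta>) t)\<bar>"
        unfolding real_norm_def abs_mult using \<open>0 < t\<close> by (intro mult_right_mono Re_le_1) auto
      also have "\<dots> \<le> e + E * (cos \<theta>)\<^sup>2 + c"
        using c[of "\<xi> * cos \<theta>"] by (simp add: E_def power_mult_distrib ac_simps)
      also have "\<dots> = (e + E / 2 + c) + E / 2 * cos (real 2 * \<theta>)"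
        unfolding half by (simp add: algebra_simps)
      finally show "norm (Re (\<phi> (\<xi> * sin \<theta>) t) * Im (\<phi> (\<xi> * cos \<theta>) t)) \<le> \<dots>" .
    qed (use \<open>0 < t\<close> in \<open>auto intro!: continuous_intros\<close>)
    also have "\<dots> = e + E / 2 + c" by (rule circle_avg_harmonic) simp
    finally show "norm (circle_avg (\<lambda>\<theta>. Re (\<phi> (\<xi> * sin \<theta>) t) * Im (\<phi> (\<xi> * cos \<theta>) t)))
        \<le> - (K * \<xi>\<^sup>2 * exp (- (t / 2)) / 2) + ?W \<xi> t + 2 * c"
      using \<open>0 \<le> c\<close> by (simp add: E_def)
  qed (use assms Im_equation in auto)
  then show ?thesis by simp
qed

text \<open>The quadratic term is reproduced exactly by the sum over sine and cosine, whereas the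
  quartic one shrinks by 3/4, which gives the rate 1 - 3/4. Subtracting the stationary Gaussian
  turns the quadratic equation into an estimate on differences.\<close>

lemma Re_decay:
  assumes "0 \<le> t" "0 \<le> e" "0 \<le> K" "0 \<le> s"
    and init: "\<And>\<xi>. \<bar>Re (\<phi> \<xi> 0) - exp (- (s * \<xi>\<^sup>2))\<bar> \<le> e * \<xi>\<^sup>2 + K * \<xi> ^ 4"
  shows "\<bar>Re (\<phi> \<xi> t) - exp (- (s * \<xi>\<^sup>2))\<bar> \<le> e * \<xi>\<^sup>2 + K * \<xi> ^ 4 * exp (- (t / 4))"
proof -
  let ?W = "\<lambda>\<xi> t. e * \<xi>\<^sup>2 + K * \<xi> ^ 4 * exp (- (t / 4))"
  let ?R = "\<lambda>\<xi> t \<theta>. Re (\<phi> (\<xi> * sin \<theta>) t) * Re (\<phi> (\<xi> * cos \<theta>) t)"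
  define g where "g \<xi> = exp (- (s * \<xi>\<^sup>2))" for \<xi>
  have g: "0 \<le> g \<xi>" "g \<xi> \<le> 1" for \<xi> using \<open>0 \<le> s\<close> by (simp_all add: g_def)
  have gg: "g (\<xi> * sin \<theta>) * g (\<xi> * cos \<theta>) = g \<xi>" for \<xi> \<theta>
    unfolding g_def by (rule gaussian_mult_sin_cos)
  have "norm (Re (\<phi> \<xi> t) - g \<xi>) \<le> ?W \<xi> t"
  proof (rule comparison[where S = UNIV and B = 2 and W = ?W and f = "\<lambda>\<xi> t. Re (\<phi> \<xi> t) - g \<xi>"
        and k = "\<lambda>\<xi> t. circle_avg (?R \<xi> t) - g \<xi>"
        and W' = "\<lambda>\<xi> t. - (K * \<xi> ^ 4 * exp (- (t / 4)) / 4)"])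
    show "continuous_on {0..} (\<lambda>t. Re (\<phi> \<xi> t) - g \<xi>)" for \<xi>
      by (intro continuous_intros cont_time)
    show "continuous_on {0..} (?W \<xi>)" for \<xi>
      by (intro continuous_intros) auto
    show "((\<lambda>t. Re (\<phi> \<xi> t) - g \<xi>) has_vector_derivative
        circle_avg (?R \<xi> t) - g \<xi> - (Re (\<phi> \<xi> t) - g \<xi>)) (at t)" if "0 < t" for \<xi> t
      using has_vector_derivative_diff[OF Re_equation[OF that, of \<xi>] has_vector_derivative_const] by simp
    show "(?W \<xi> has_vector_derivative - (K * \<xi> ^ 4 * exp (- (t / 4)) / 4)) (at t)" for \<xi> t
      unfolding has_real_derivative_iff_has_vector_derivative[symmetric]
      by (rule derivative_eq_intros refl | simp)+
    show "norm (Re (\<phi> \<xi> t) - g \<xi>) \<le> ?W \<xi> t + 2" if "0 \<le> t" for \<xi> t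
    proof -
      have "0 \<le> ?W \<xi> t" using assms by simp
      then show ?thesis using Re_le_1[OF that, of \<xi>] g[of \<xi>] by simp
    qed
    show "norm (Re (\<phi> \<xi> 0) - g \<xi>) \<le> ?W \<xi> 0" for \<xi>
      using init by (simp add: g_def)
  next
    fix \<xi> t c :: real
    assume "0 < t" "0 \<le> c" and c: "\<And>\<xi>. \<xi> \<in> UNIV \<Longrightarrow> norm (Re (\<phi> \<xi> t) - g \<xi>) \<le> ?W \<xi> t + c"
    define E where "E = K * \<xi> ^ 4 * exp (- (t / 4))"
    have "circle_avg (\<lambda>\<theta>. g \<xi>) = g \<xi>"
      using circle_avg_harmonic[of 1 "g \<xi>" 0] by simp
    \<comment> \<open>The constant \<open>g \<xi>\<close> is its own average, so it can be moved
      under the integral and split there into its two Gaussian factors.\<close>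
    then have diff: "circle_avg (?R \<xi> t) - g \<xi> = circle_avg (\<lambda>\<theta>. ?R \<xi> t \<theta> - g \<xi>)"
      using \<open>0 < t\<close> by (subst circle_avg_diff) (auto intro!: continuous_intros)
    have "norm (circle_avg (?R \<xi> t) - g \<xi>) \<le> circle_avg (\<lambda>\<theta>. (e * \<xi>\<^sup>2 + 3 / 4 * E + 2 * c) + E / 4 * cos (real 4 * \<theta>))"
      unfolding diff
    proof (rule norm_circle_avg_le)
      fix \<theta> :: real
      have cs: "(sin \<theta>)\<^sup>2 = 1 - (cos \<theta>)\<^sup>2" by (rule sin_squared_eq)
      have "cos (4 * \<theta>) = 2 * (2 * (cos \<theta>)\<^sup>2 - 1)\<^sup>2 - 1"
        using cos_double_cos[of "2 * \<theta>"] cos_double_cos[of \<theta>] by simp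
      moreover have "sin \<theta> ^ 4 = (1 - (cos \<theta>)\<^sup>2)\<^sup>2"
        unfolding cs[symmetric] by simp
      ultimately have quartic: "sin \<theta> ^ 4 + cos \<theta> ^ 4 = 3 / 4 + cos (4 * \<theta>) / 4"
        by (simp add: power2_eq_square power4_eq_xxxx algebra_simps)
      \<comment> \<open>Factors bounded by 1 turn the difference of products into a sum of two
        differences; this is the origin of the \<open>2 * c\<close> in
        \<open>comparison\<close>.\<close>
      have "norm (?R \<xi> t \<theta> - g \<xi>) \<le> \<bar>Re (\<phi> (\<xi> * sin \<theta>) t) - g (\<xi> * sin \<theta>)\<bar> + \<bar>Re (\<phi> (\<xi> * cos \<theta>) t) - g (\<xi> * cos \<theta>)\<bar>"
        unfolding gg[of \<xi> \<theta>, symmetric] real_norm_def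
        using \<open>0 < t\<close> g[of "\<xi> * sin \<theta>"] by (intro abs_mult_diff_le Re_le_1) auto
      also have "\<dots> \<le> (?W (\<xi> * sin \<theta>) t + c) + (?W (\<xi> * cos \<theta>) t + c)"
        using c by (intro add_mono) auto
      also have "\<dots> = e * \<xi>\<^sup>2 * ((sin \<theta>)\<^sup>2 + (cos \<theta>)\<^sup>2) + E * (sin \<theta> ^ 4 + cos \<theta> ^ 4) + 2 * c"
        by (simp only: E_def power_mult_distrib distrib_left distrib_right) (simp only: ac_simps mult_2)
      also have "\<dots> = (e * \<xi>\<^sup>2 + 3 / 4 * E + 2 * c) + E / 4 * cos (real 4 * \<theta>)"
        unfolding quartic by (simp add: algebra_simps)
      finally show "norm (?R \<xi> t \<theta> - g \<xi>) \<le> \<dots>" .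
    qed (use \<open>0 < t\<close> in \<open>auto intro!: continuous_intros\<close>)
    also have "\<dots> = e * \<xi>\<^sup>2 + 3 / 4 * E + 2 * c" by (rule circle_avg_harmonic) simp
    finally show "norm (circle_avg (?R \<xi> t) - g \<xi>) \<le> - (K * \<xi> ^ 4 * exp (- (t / 4)) / 4) + ?W \<xi> t + 2 * c"
      by (simp add: E_def)
  qed (use assms in auto)
  then show ?thesis by (simp add: g_def)
qed

text \<open>The interval from \<open>-r\<close> to \<open>r\<close> is stable under multiplication
  by sines and cosines, so the comparison can be run on it alone, with the stationary Gaussian as a
  majorant constant in time.\<close>

lemma Re_gaussian_bound:
  assumes "0 \<le> t" "0 \<le> A" "\<bar>\<xi>\<bar> \<le> r"
    and init: "\<And>\<xi>. \<bar>\<xi>\<bar> \<le> r \<Longrightarrow> \<bar>Re (\<phi> \<xi> 0)\<bar> \<le> exp (- (A * \<xi>\<^sup>2))"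
  shows "\<bar>Re (\<phi> \<xi> t)\<bar> \<le> exp (- (A * \<xi>\<^sup>2))"
proof -
  let ?R = "\<lambda>\<xi> t \<theta>. Re (\<phi> (\<xi> * sin \<theta>) t) * Re (\<phi> (\<xi> * cos \<theta>) t)"
  define g where "g \<xi> = exp (- (A * \<xi>\<^sup>2))" for \<xi>
  have g: "0 \<le> g \<xi>" "g \<xi> \<le> 1" for \<xi> using \<open>0 \<le> A\<close> by (simp_all add: g_def)
  have gg: "g (\<xi> * sin \<theta>) * g (\<xi> * cos \<theta>) = g \<xi>" for \<xi> \<theta>
    unfolding g_def by (rule gaussian_mult_sin_cos)
  have "norm (Re (\<phi> \<xi> t)) \<le> g \<xi>"
  proof (rule comparison[where S = "{-r..r}" and B = 1 and W = "\<lambda>\<xi> t. g \<xi>" and f = "\<lambda>\<xi> t. Re (\<phi> \<xi> t)"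
        and k = "\<lambda>\<xi> t. circle_avg (?R \<xi> t)" and W' = "\<lambda>\<xi> t. 0"])
    show "continuous_on {0..} (\<lambda>t. Re (\<phi> \<xi> t))" for \<xi>
      by (intro continuous_intros cont_time)
    show "norm (Re (\<phi> \<xi> t)) \<le> g \<xi> + 1" if "0 \<le> t" for \<xi> t
      using Re_le_1[OF that, of \<xi>] g[of \<xi>] by simp
  next
    fix \<xi> t c :: real
    assume \<xi>: "\<xi> \<in> {-r..r}" and "0 < t" "0 \<le> c" and c: "\<And>\<xi>. \<xi> \<in> {-r..r} \<Longrightarrow> norm (Re (\<phi> \<xi> t)) \<le> g \<xi> + c"
    have "norm (circle_avg (?R \<xi> t)) \<le> circle_avg (\<lambda>\<theta>. (g \<xi> + 2 * c) + 0 * cos (real 1 * \<theta>))"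
    proof (rule norm_circle_avg_le)
      fix \<theta> :: real
      have "\<bar>\<xi> * sin \<theta>\<bar> \<le> \<bar>\<xi>\<bar> * 1" "\<bar>\<xi> * cos \<theta>\<bar> \<le> \<bar>\<xi>\<bar> * 1"
        unfolding abs_mult by (intro mult_left_mono; simp)+
      with \<xi> have *: "\<xi> * sin \<theta> \<in> {-r..r}" "\<xi> * cos \<theta> \<in> {-r..r}"
        by (auto simp: abs_le_iff)
      have "norm (?R \<xi> t \<theta>) = \<bar>Re (\<phi> (\<xi> * sin \<theta>) t)\<bar> * \<bar>Re (\<phi> (\<xi> * cos \<theta>) t)\<bar>"
        by (simp add: abs_mult)
      \<comment> \<open>The factors are replaced one at a time: bounding the remaining real part by
        1 next to \<open>c\<close> avoids a term \<open>c\<^sup>2\<close> and keeps the excess at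
        \<open>2 * c\<close>.\<close>
      also have "\<dots> \<le> (g (\<xi> * sin \<theta>) + c) * \<bar>Re (\<phi> (\<xi> * cos \<theta>) t)\<bar>"
        using c[OF *(1)] by (intro mult_right_mono) auto
      also have "\<dots> = g (\<xi> * sin \<theta>) * \<bar>Re (\<phi> (\<xi> * cos \<theta>) t)\<bar> + c * \<bar>Re (\<phi> (\<xi> * cos \<theta>) t)\<bar>"
        by (simp add: algebra_simps)
      also have "\<dots> \<le> g (\<xi> * sin \<theta>) * (g (\<xi> * cos \<theta>) + c) + c * 1"
        using c[OF *(2)] g \<open>0 \<le> c\<close> \<open>0 < t\<close> by (intro add_mono mult_left_mono Re_le_1) auto
      also have "\<dots> \<le> g \<xi> + 1 * c + c"
        using mult_right_mono[OF g(2) \<open>0 \<le> c\<close>, of "\<xi> * sin \<theta>"] gg[of \<xi> \<theta>] by (simp add: algebra_simps)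
      finally show "norm (?R \<xi> t \<theta>) \<le> (g \<xi> + 2 * c) + 0 * cos (real 1 * \<theta>)" by simp
    qed (use \<open>0 < t\<close> in \<open>auto intro!: continuous_intros\<close>)
    also have "\<dots> = g \<xi> + 2 * c" by (rule circle_avg_harmonic) simp
    finally show "norm (circle_avg (?R \<xi> t)) \<le> 0 + g \<xi> + 2 * c" by simp
  qed (use assms Re_equation in \<open>auto simp: g_def abs_le_iff\<close>)
  then show ?thesis by (simp add: g_def)
qed

section \<open>Long-time limits of the solution\<close>

text \<open>Initially the imaginary part is below \<open>e\<close> near the origin by continuity;
  farther out it is at most 1, hence at most \<open>\<xi>\<^sup>2 / r\<^sup>2\<close>. So
  \<open>Im_decay\<close> applies for every \<open>e\<close>.\<close>

lemma Im_tendsto_0: "((\<lambda>t. Im (\<phi> \<xi> t)) \<longlongrightarrow> 0) at_top"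
proof (rule tendsto_0_of_exp_bound[where a = "1 / 2" and C = 1])
  fix e :: real assume "0 < e"
  interpret M0: real_distribution "\<mu> 0" by (simp add: distribution)
  have "isCont (\<lambda>\<xi>. Im (\<phi> \<xi> 0)) 0"
    using cont_freq[of 0 UNIV "\<lambda>x. x"]
    by (intro isCont_Im) (simp add: continuous_on_eq_continuous_at)
  moreover have "Im (\<phi> 0 0) = 0" by (simp add: transform M0.char_zero)
  ultimately obtain r where "0 < r" and r: "\<And>\<xi>. \<bar>\<xi>\<bar> < r \<Longrightarrow> \<bar>Im (\<phi> \<xi> 0)\<bar> < e"
    using \<open>0 < e\<close> unfolding continuous_at_eps_delta by (auto simp: dist_real_def)
  have "\<bar>Im (\<phi> \<xi> 0)\<bar> \<le> e + 1 / r\<^sup>2 * \<xi>\<^sup>2" for \<xi>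
  proof (cases "\<bar>\<xi>\<bar> < r")
    case False
    then have "r\<^sup>2 \<le> \<xi>\<^sup>2" using \<open>0 < r\<close> by (simp add: abs_le_square_iff[symmetric])
    then have "1 \<le> 1 / r\<^sup>2 * \<xi>\<^sup>2" using \<open>0 < r\<close> by simp
    then show ?thesis using Im_le_1[of 0 \<xi>] \<open>0 < e\<close> by linarith
  qed (use r[of \<xi>] in \<open>simp add: add_increasing2\<close>)
  then show "\<exists>K. \<forall>t\<ge>0. \<bar>Im (\<phi> \<xi> t)\<bar> \<le> e * 1 + K * exp (- (1 / 2 * t))"
    using Im_decay[of _ e "1 / r\<^sup>2" \<xi>] \<open>0 < e\<close> by (intro exI[of _ "1 / r\<^sup>2 * \<xi>\<^sup>2"]) simp
qed simp

lemma finite_variance_limit: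
  assumes int: "integrable (\<mu> 0) (\<lambda>x. x\<^sup>2)"
  shows "(\<phi> \<xi> \<longlongrightarrow> complex_of_real (exp (- ((\<integral>x. x\<^sup>2 \<partial>\<mu> 0) * \<xi>\<^sup>2 / 2)))) at_top"
proof -
  interpret M0: real_distribution "\<mu> 0" by (simp add: distribution)
  define s where "s = (\<integral>x. x\<^sup>2 \<partial>\<mu> 0) / 2"
  have "0 \<le> s" by (simp add: s_def)
  have "((\<lambda>t. Re (\<phi> \<xi> t) - exp (- (s * \<xi>\<^sup>2))) \<longlongrightarrow> 0) at_top"
  proof (rule tendsto_0_of_exp_bound[where a = "1 / 4" and C = "\<xi>\<^sup>2"])
    fix e :: real assume "0 < e"
    obtain r where "0 < r" and r: "\<And>\<xi>. \<bar>\<xi>\<bar> < r \<Longrightarrow> \<bar>Re (\<phi> \<xi> 0) - (1 - s * \<xi>\<^sup>2)\<bar> \<le> e * \<xi>\<^sup>2"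
      using M0.Re_char_second_order[OF int \<open>0 < e\<close>] by (auto simp: s_def transform)
    \<comment> \<open>The first summand covers the error of linearising the Gaussian when |\<xi>| <
      r. The second makes the quartic term at least 2 beyond that, where the difference is trivially
      at most 2.\<close>
    define K where "K = s\<^sup>2 / 2 + 2 / r ^ 4"
    have "0 \<le> K" by (simp add: K_def)
    have "\<bar>Re (\<phi> \<xi> 0) - exp (- (s * \<xi>\<^sup>2))\<bar> \<le> e * \<xi>\<^sup>2 + K * \<xi> ^ 4" for \<xi>
    proof (cases "\<bar>\<xi>\<bar> < r")
      case True
      have "\<bar>exp (- (s * \<xi>\<^sup>2)) - (1 - s * \<xi>\<^sup>2)\<bar> \<le> (s * \<xi>\<^sup>2)\<^sup>2 / 2"
        using \<open>0 \<le> s\<close> by (intro abs_exp_minus_quadratic_le) simp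
      also have "\<dots> \<le> K * \<xi> ^ 4"
        by (simp add: K_def power_mult_distrib distrib_right)
      finally show ?thesis using r[OF True] by linarith
    next
      case False
      then have "r ^ 4 \<le> \<bar>\<xi>\<bar> ^ 4" using \<open>0 < r\<close> by (intro power_mono) auto
      then have "2 \<le> 2 / r ^ 4 * \<xi> ^ 4" using \<open>0 < r\<close> by (simp add: pos_le_divide_eq)
      also have "\<dots> \<le> K * \<xi> ^ 4" by (intro mult_right_mono) (simp_all add: K_def)
      also have "\<dots> \<le> e * \<xi>\<^sup>2 + K * \<xi> ^ 4" using \<open>0 < e\<close> by simp
      moreover have "0 \<le> exp (- (s * \<xi>\<^sup>2))" "exp (- (s * \<xi>\<^sup>2)) \<le> 1" using \<open>0 \<le> s\<close> by simp_all
      ultimately show ?thesis using Re_le_1[of 0 \<xi>] by linarith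
    qed
    from Re_decay[OF _ _ \<open>0 \<le> K\<close> \<open>0 \<le> s\<close> this]
    show "\<exists>K. \<forall>t\<ge>0. \<bar>Re (\<phi> \<xi> t) - exp (- (s * \<xi>\<^sup>2))\<bar> \<le> e * \<xi>\<^sup>2 + K * exp (- (1 / 4 * t))"
      using \<open>0 < e\<close> by (intro exI[of _ "K * \<xi> ^ 4"]) simp
  qed simp
  then have "((\<lambda>t. Re (\<phi> \<xi> t)) \<longlongrightarrow> exp (- (s * \<xi>\<^sup>2))) at_top"
    by (rule LIM_zero_cancel)
  with Im_tendsto_0[of \<xi>] show ?thesis
    by (subst tendsto_complex_iff) (simp add: s_def)
qed

lemma gaussian_limit_imp_finite_variance:
  assumes "0 < \<sigma>"
    and lim: "\<And>\<xi>. (\<phi> \<xi> \<longlongrightarrow> complex_of_real (exp (- (\<sigma>\<^sup>2 * \<xi>\<^sup>2 / 2)))) at_top"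
  shows "integrable (\<mu> 0) (\<lambda>x. x\<^sup>2)"
proof (rule ccontr)
  interpret M0: real_distribution "\<mu> 0" by (simp add: distribution)
  assume "\<not> integrable (\<mu> 0) (\<lambda>x. x\<^sup>2)"
  \<comment> \<open>The coefficient \<open>\<sigma>\<^sup>2\<close> is twice the one in the exponent
    of the supposed limit.\<close>
  then obtain r where "0 < r" and r: "\<And>\<xi>. \<bar>\<xi>\<bar> \<le> r \<Longrightarrow> Re (\<phi> \<xi> 0) \<le> 1 - \<sigma>\<^sup>2 * \<xi>\<^sup>2"
    using M0.Re_char_infinite_variance[of "\<sigma>\<^sup>2"] by (auto simp: transform)
  \<comment> \<open>The propagated bound concerns the absolute value; continuity makes the real part
    positive near the origin, so the upper bound suffices there.\<close>
  have "isCont (\<lambda>\<xi>. Re (\<phi> \<xi> 0)) 0"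
    using cont_freq[of 0 UNIV "\<lambda>x. x"]
    by (intro isCont_Re) (simp add: continuous_on_eq_continuous_at)
  moreover have "Re (\<phi> 0 0) = 1" by (simp add: transform M0.char_zero)
  ultimately obtain d where "0 < d" and d: "\<And>\<xi>. \<bar>\<xi>\<bar> < d \<Longrightarrow> \<bar>Re (\<phi> \<xi> 0) - 1\<bar> < 1"
    unfolding continuous_at_eps_delta dist_real_def by (metis diff_zero zero_less_one)
  define \<rho> where "\<rho> = min r (d / 2)"
  have \<rho>: "0 < \<rho>" "\<rho> \<le> r" "\<rho> < d" using \<open>0 < r\<close> \<open>0 < d\<close> by (simp_all add: \<rho>_def min_def)
  have init: "\<bar>Re (\<phi> \<xi> 0)\<bar> \<le> exp (- (\<sigma>\<^sup>2 * \<xi>\<^sup>2))" if "\<bar>\<xi>\<bar> \<le> \<rho>" for \<xi>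
    using d[of \<xi>] r[of \<xi>] that \<rho> exp_ge_add_one_self[of "- (\<sigma>\<^sup>2 * \<xi>\<^sup>2)"] by linarith
  have "\<bar>Re (\<phi> \<rho> t)\<bar> \<le> exp (- (\<sigma>\<^sup>2 * \<rho>\<^sup>2))" if "0 \<le> t" for t
    by (rule Re_gaussian_bound[where r = \<rho> and \<xi> = \<rho>]) (use that \<rho>(1) init in simp_all)
  then have "\<forall>\<^sub>F t in at_top. Re (\<phi> \<rho> t) \<le> exp (- (\<sigma>\<^sup>2 * \<rho>\<^sup>2))"
    by (intro eventually_mono[OF eventually_ge_at_top[of 0]]) (simp add: abs_le_iff)
  \<comment> \<open>At the single frequency \<open>\<rho>\<close> the bound holds for all times and
    passes to the limit, which is strictly larger: a contradiction.\<close>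
  from tendsto_upperbound[OF tendsto_Re[OF lim[of \<rho>]] this]
  have "exp (- (\<sigma>\<^sup>2 * \<rho>\<^sup>2 / 2)) \<le> exp (- (\<sigma>\<^sup>2 * \<rho>\<^sup>2))" by simp
  moreover have "0 < \<sigma>\<^sup>2 * \<rho>\<^sup>2" using \<open>0 < \<sigma>\<close> \<rho> by simp
  ultimately show False unfolding exp_le_cancel_iff by linarith
qed

end

theorem theorem1:
  fixes \<mu>0 :: "real measure"
    and \<phi> :: "real \<Rightarrow> real \<Rightarrow> complex"
    and \<mu> :: "real \<Rightarrow> real measure"
    and \<sigma> :: real
  assumes "real_distribution \<mu>0"
    and "nondegenerate \<mu>0"
    and "kac_solution (char \<mu>0) \<phi>"
    and "\<And>t. t \<ge> 0 \<Longrightarrow> real_distribution (\<mu> t)"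
    and "\<And>t \<xi>. t \<ge> 0 \<Longrightarrow> \<phi> \<xi> t = char (\<mu> t) \<xi>"
    and "\<sigma> > 0"
  shows "((\<lambda>t. SUP v. \<bar>cdf (\<mu> t) v - gaussian_cdf \<sigma> v\<bar>) \<longlongrightarrow> 0) at_top
     \<longleftrightarrow> integrable \<mu>0 (\<lambda>x. x\<^sup>2) \<and> \<sigma>\<^sup>2 = (\<integral>x. x\<^sup>2 \<partial>\<mu>0)"
proof -
  interpret kac_flow \<phi> \<mu>
  proof (rule kac_flow.intro)
    show "continuous_on {0..} (\<phi> \<xi>)" for \<xi>
      using assms(3) unfolding kac_solution_def by blast
    show "(\<phi> \<xi> has_vector_derivative
          circle_avg (\<lambda>\<theta>. \<phi> (\<xi> * sin \<theta>) t * \<phi> (\<xi> * cos \<theta>) t) - \<phi> \<xi> t) (at t)" if "0 < t" for \<xi> t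
      using assms(3) that unfolding kac_solution_def circle_avg_def by blast
    show "real_distribution (\<mu> t)" "\<phi> \<xi> t = char (\<mu> t) \<xi>" if "0 \<le> t" for t \<xi>
      using that by (fact assms(4), fact assms(5))
  qed
  \<comment> \<open>At time 0 the solution is the transform of both measures, so Levy uniqueness
    identifies them.\<close>
  have "char \<mu>0 = char (\<mu> 0)"
    using assms(3) assms(5)[of 0] unfolding kac_solution_def by (intro ext) (metis order_refl)
  then have \<mu>0: "\<mu>0 = \<mu> 0"
    by (intro Levy_uniqueness assms(1) distribution) simp_all
  have "((\<lambda>t. char (\<mu> t) \<xi>) \<longlongrightarrow> l) at_top \<longleftrightarrow> (\<phi> \<xi> \<longlongrightarrow> l) at_top" for \<xi> l
    by (intro tendsto_cong eventually_mono[OF eventually_ge_at_top[of 0]]) (simp add: transform)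
  then have "((\<lambda>t. SUP v. \<bar>cdf (\<mu> t) v - gaussian_cdf \<sigma> v\<bar>) \<longlongrightarrow> 0) at_top \<longleftrightarrow>
      (\<forall>\<xi>. (\<phi> \<xi> \<longlongrightarrow> complex_of_real (exp (- (\<sigma>\<^sup>2 * \<xi>\<^sup>2 / 2)))) at_top)" (is "_ \<longleftrightarrow> ?lim")
    by (simp add: uniform_cdf_gaussian_iff_char distribution \<open>\<sigma> > 0\<close>)
  also have "?lim \<longleftrightarrow> integrable (\<mu> 0) (\<lambda>x. x\<^sup>2) \<and> \<sigma>\<^sup>2 = (\<integral>x. x\<^sup>2 \<partial>\<mu> 0)"
  proof
    assume lim: ?lim
    with gaussian_limit_imp_finite_variance[OF \<open>\<sigma> > 0\<close>] have int: "integrable (\<mu> 0) (\<lambda>x. x\<^sup>2)" by blast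
    \<comment> \<open>Finite variance yields a second Gaussian limit; comparing the two at frequency
      1 already identifies the variances.\<close>
    from tendsto_unique[OF _ finite_variance_limit[OF int, of 1] lim[rule_format, of 1]]
    have "\<sigma>\<^sup>2 = (\<integral>x. x\<^sup>2 \<partial>\<mu> 0)"
      unfolding of_real_eq_iff exp_inj_iff by simp
    with int show "integrable (\<mu> 0) (\<lambda>x. x\<^sup>2) \<and> \<sigma>\<^sup>2 = (\<integral>x. x\<^sup>2 \<partial>\<mu> 0)" ..
  next
    assume "integrable (\<mu> 0) (\<lambda>x. x\<^sup>2) \<and> \<sigma>\<^sup>2 = (\<integral>x. x\<^sup>2 \<partial>\<mu> 0)"
    then show ?lim using finite_variance_limit by simp
  qed
  finally show ?thesis by (simp only: \<mu>0)
qed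

end
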